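(* Let $G(s)=(V,E)$ be a labelled finite graph (loops and multiple edges allowed) with $|E|=n$, and let $f$ be a discrete harmonic function on $E$ (that is, $f\in\mathrm{Harm}_d(n)$, transported to $E$ by the label $s$). Then, with $\lambda=1+q$, $$\chi_f(G(s);\lambda)=\sum_i(-1)^{i+1}\cdot fq\mathrm{dim}\big(C^i(G(s))\big).$$ Also, with $\lambda=1+q$, $$\widehat\chi_f(G;\lambda)=\sum_{s}\sum_i(-1)^{i+1}\cdot fq\mathrm{dim}\big(C^i(G(s))\big),$$ where the outer sum runs over all labels $s$ of $G$.
   Context: Let $\Omega=\{1,\dots,n\}$ and $\Omega_d=\{Z\subset\Omega:|Z|=d\}$. Functions $f:\Omega_d\to\mathbb R$ are identified with formal sums $f=\sum_{Z\in\Omega_d}f(Z)Z\in\mathbb R\Omega_d$. Let $\gamma$ be the linear map with $\gamma(Z)=\sum_{Y\in\Omega_{d-1},\,Y\subset Z}Y$ for $Z\in\Omega_d$; $\mathrm{Harm}_d(n)=\ker(\gamma|_{\mathbb R\Omega_d})$, and its elements are the discrete harmonic functions of degree $d$. For $X\subset\Omega$ put $\widetilde f(X)=\sum_{Z\in\Omega_d,\,Z\subset X}f(Z)$. A label of $G$ is a bijection $s:E\to\Omega$; $S(G)$ is the set of all labels, and $G(s)$ denotes $G$ with edges indexed by $s$. For $A\subset E$, $G_A=(V,A)$ and $k(G_A)$ is its number of connected components. The weighted chromatic polynomial is $\chi_f(G(s);\lambda)=\sum_{A\subset E}\widetilde f(s(E\setminus A))(-1)^{|A|}\lambda^{k(G_A)}$,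 and $\widehat\chi_f(G;\lambda)=\sum_{s\in S(G)}\chi_f(G(s);\lambda)$. Let $M=M_0\oplus M_1$ be the graded free $\mathbb Z$-module with $M_0$ generated by the basis element $1$ in degree $0$ and $M_1$ generated by the basis element $x$ in degree $1$. Spanning subgraphs of $G(s)$ correspond to edge vectors $\epsilon\in\{0,1\}^n$, where $\epsilon_i=1$ iff the $i$-th edge is present; $G_\epsilon$ is the corresponding spanning subgraph and $l(\epsilon)$ the number of ones in $\epsilon$. The $i$-th chromatic cochain group is the graded module $$C^i(G(s))=\bigoplus_{l(\epsilon)=i}M^{\otimes k(G_\epsilon)}.$$ The summand indexed by $\epsilon$ is assigned the $f$-value of the corresponding edge set, namely $\widetilde f(\{j:\epsilon_j=1\})$. For a $\mathbb Z$-module $N=\bigoplus_j N_j$ whose summands have $f$-values $f(N_j)$, $f\mathrm{rank}(N)=\sum_j f(N_j)\cdot\dim_{\mathbb Q}(N_j\otimes\mathbb Q)$. For a graded module $\mathcal N$ with degree-$j$ homogeneous part $N_j$ (decomposed into parts with $f$-values), the $f$-value graded dimension is $fq\mathrm{dim}(\mathcal N)=\sum_j q^j\cdot f\mathrm{rank}(N_j)$. For instance, the summand indexed by $\epsilon$ contributes $\widetilde f(\{j:\epsilon_j=1\})(1+q)^{k(G_\epsilon)}$.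
   Formalization: The sign (-1)^{i+1} is wrong for even d (e.g. d=0, one vertex, no edges); the first formula is stated as printed only for odd d, the second only for d>0, and both are given for all d with the corrected sign (-1)^{i+d}. *)

theory Defs
  imports
    "HOL-Library.FuncSet"
    "HOL-Library.Poly_Mapping"
    "HOL-Computational_Algebra.Polynomial"
begin

section \<open>Discrete harmonic functions\<close>

definition Omega :: "nat \<Rightarrow> nat \<Rightarrow> nat set set" where
  "Omega n d = {Z. Z \<subseteq> {1..n} \<and> card Z = d}"

text \<open>The coefficient of \<open>Y\<close> in \<open>\<gamma>(Z)\<close>. For \<open>d = 0\<close> the truncated \<open>d - 1\<close> is harmless: no set is
  a proper subset of \<open>Z = {}\<close>, so \<open>\<gamma>({}) = 0\<close>.\<close>
definition gamma_coeff :: "nat \<Rightarrow> nat \<Rightarrow> nat set \<Rightarrow> nat set \<Rightarrow> real" where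
  "gamma_coeff n d Z Y = (if Y \<in> Omega n (d - 1) \<and> Y \<subset> Z then 1 else 0)"

definition gamma :: "nat \<Rightarrow> nat \<Rightarrow> (nat set \<Rightarrow> real) \<Rightarrow> (nat set \<Rightarrow> real)" where
  "gamma n d f = (\<lambda>Y. \<Sum>Z\<in>Omega n d. f Z * gamma_coeff n d Z Y)"

text \<open>A formal sum in \<open>\<real>\<Omega>\<^sub>d\<close> is a function on all sets that vanishes outside \<open>\<Omega>\<^sub>d\<close>.\<close>
definition Harm :: "nat \<Rightarrow> nat \<Rightarrow> (nat set \<Rightarrow> real) set" where
  "Harm d n = {f. (\<forall>Z. Z \<notin> Omega n d \<longrightarrow> f Z = 0) \<and> gamma n d f = (\<lambda>_. 0)}"

definition tilde :: "nat \<Rightarrow> nat \<Rightarrow> (nat set \<Rightarrow> real) \<Rightarrow> nat set \<Rightarrow> real" where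
  "tilde n d f X = (\<Sum>Z | Z \<in> Omega n d \<and> Z \<subseteq> X. f Z)"

section \<open>Finite graphs with loops and multiple edges\<close>

record ('v, 'e) multigraph =
  verts :: "'v set"
  edges :: "'e set"
  ends :: "'e \<Rightarrow> 'v set"

text \<open>An edge with a single end is a loop.\<close>
definition finite_multigraph :: "('v, 'e) multigraph \<Rightarrow> bool" where
  "finite_multigraph G \<longleftrightarrow> finite (verts G) \<and> finite (edges G) \<and>
     (\<forall>e\<in>edges G. ends G e \<subseteq> verts G \<and> card (ends G e) \<in> {1, 2})"

definition connection :: "('v, 'e) multigraph \<Rightarrow> 'e set \<Rightarrow> ('v \<times> 'v) set" where
  "connection G A =
     {(u, v). u \<in> verts G \<and> v \<in> verts G \<and> (u, v) \<in> {(x, y). \<exists>e\<in>A. ends G e = {x, y}}\<^sup>*}"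

text \<open>The number \<open>k(G\<^sub>A)\<close> of connected components of the spanning subgraph \<open>(V, A)\<close>.\<close>
definition ncomp :: "('v, 'e) multigraph \<Rightarrow> 'e set \<Rightarrow> nat" where
  "ncomp G A = card (verts G // connection G A)"

text \<open>Labels are taken extensional, so that they are exactly the bijections \<open>E \<rightarrow> \<Omega>\<close> and there are
  finitely many of them.\<close>
definition labels :: "('v, 'e) multigraph \<Rightarrow> ('e \<Rightarrow> nat) set" where
  "labels G = {s \<in> edges G \<rightarrow>\<^sub>E {1..card (edges G)}. bij_betw s (edges G) {1..card (edges G)}}"

section \<open>The weighted chromatic polynomial\<close>

text \<open>As a polynomial in \<open>\<lambda>\<close>.\<close>
definition wchrom ::
  "nat \<Rightarrow> (nat set \<Rightarrow> real) \<Rightarrow> ('v, 'e) multigraph \<Rightarrow> ('e \<Rightarrow> nat) \<Rightarrow> real poly" where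
  "wchrom d f G s = (\<Sum>A\<in>Pow (edges G).
     monom (tilde (card (edges G)) d f (s ` (edges G - A)) * (-1) ^ card A) (ncomp G A))"

definition wchrom_sum :: "nat \<Rightarrow> (nat set \<Rightarrow> real) \<Rightarrow> ('v, 'e) multigraph \<Rightarrow> real poly" where
  "wchrom_sum d f G = (\<Sum>s\<in>labels G. wchrom d f G s)"

section \<open>Graded modules and their tensor powers\<close>

text \<open>All modules in question are submodules of a free module \<open>\<int>\<^sup>(\<^sup>B\<^sup>)\<close>, represented by
  \<open>B \<Rightarrow>\<^sub>0 int\<close>. A graded module is given by its family of homogeneous parts.\<close>
type_synonym 'b graded = "nat \<Rightarrow> ('b \<Rightarrow>\<^sub>0 int) set"

abbreviation zspan :: "('b \<Rightarrow>\<^sub>0 int) set \<Rightarrow> ('b \<Rightarrow>\<^sub>0 int) set" where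
  "zspan \<equiv> module.span frag_cmul"

datatype gen = Gen_1 | Gen_x

fun gen_deg :: "gen \<Rightarrow> nat" where
  "gen_deg Gen_1 = 0"
| "gen_deg Gen_x = 1"

definition M :: "gen graded" where
  "M j = zspan (frag_of ` {b. gen_deg b = j})"

text \<open>The pure tensor \<open>m\<^sub>1 \<otimes> \<dots> \<otimes> m\<^sub>k\<close>, under the identification of \<open>\<int>\<^sup>(\<^sup>B\<^sup>) \<otimes> \<dots> \<otimes> \<int>\<^sup>(\<^sup>B\<^sup>)\<close> with the free
  module on the words of length \<open>k\<close> over \<open>B\<close>: the coefficient of the word \<open>w\<close>, that is, of
  \<open>w\<^sub>1 \<otimes> \<dots> \<otimes> w\<^sub>k\<close>, is the product of the coefficients of \<open>w\<^sub>i\<close> in \<open>m\<^sub>i\<close>.\<close>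
definition pure_tensor :: "('b \<Rightarrow>\<^sub>0 int) list \<Rightarrow> ('b list \<Rightarrow>\<^sub>0 int)" where
  "pure_tensor ms = (\<Sum>w\<in>listset (map Poly_Mapping.keys ms).
     frag_cmul (\<Prod>i<length ms. Poly_Mapping.lookup (ms ! i) (w ! i)) (frag_of w))"

text \<open>The homogeneous part of degree \<open>j\<close> of the tensor power is spanned by the pure tensors of
  homogeneous elements whose degrees sum to \<open>j\<close>.\<close>
definition tensor_power :: "'b graded \<Rightarrow> nat \<Rightarrow> 'b list graded" where
  "tensor_power N k j = zspan {pure_tensor ms | ms ds.
     length ms = k \<and> length ds = k \<and> (\<forall>i<k. ms ! i \<in> N (ds ! i)) \<and> sum_list ds = j}"

section \<open>The \<open>f\<close>-value graded dimension\<close>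

definition qscale :: "rat \<Rightarrow> ('b \<Rightarrow>\<^sub>0 rat) \<Rightarrow> ('b \<Rightarrow>\<^sub>0 rat)" where
  "qscale r p = Poly_Mapping.map ((*) r) p"

text \<open>For a submodule \<open>N\<close> of \<open>\<int>\<^sup>(\<^sup>B\<^sup>)\<close>, flatness of \<open>\<rat>\<close> identifies \<open>N \<otimes> \<rat>\<close> with the \<open>\<rat>\<close>-span of \<open>N\<close> in
  \<open>\<rat>\<^sup>(\<^sup>B\<^sup>)\<close>.\<close>
definition rationalization :: "('b \<Rightarrow>\<^sub>0 int) set \<Rightarrow> ('b \<Rightarrow>\<^sub>0 rat) set" where
  "rationalization N = module.span qscale (Poly_Mapping.map rat_of_int ` N)"

definition qdim :: "('b \<Rightarrow>\<^sub>0 int) set \<Rightarrow> nat" where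
  "qdim N = vector_space.dim qscale (rationalization N)"

text \<open>\<open>frank\<close> of the direct sum of the modules \<open>N a\<close>, \<open>a \<in> I\<close>, with \<open>f\<close>-values \<open>v a\<close>.\<close>
definition frank :: "'a set \<Rightarrow> ('a \<Rightarrow> ('b \<Rightarrow>\<^sub>0 int) set) \<Rightarrow> ('a \<Rightarrow> real) \<Rightarrow> real" where
  "frank I N v = (\<Sum>a\<in>I. v a * real (qdim (N a)))"

text \<open>A graded module presented as an (external) direct sum of graded modules, each summand carrying
  an \<open>f\<close>-value.\<close>
record ('a, 'b) fgraded =
  index :: "'a set"
  summand :: "'a \<Rightarrow> 'b graded"
  fvalue :: "'a \<Rightarrow> real"

text \<open>As a polynomial in \<open>q\<close>. Only degrees with a non-zero homogeneous part are summed over, which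
  for finitely many summands of finite rank leaves a finite sum.\<close>
definition fqdim :: "('a, 'b) fgraded \<Rightarrow> real poly" where
  "fqdim C = (\<Sum>j | \<exists>a\<in>index C. summand C a j \<noteq> {0}.
     monom (frank (index C) (\<lambda>a. summand C a j) (fvalue C)) j)"

section \<open>The chromatic cochain groups\<close>

definition edge_vectors :: "nat \<Rightarrow> (nat \<Rightarrow> nat) set" where
  "edge_vectors n = {1..n} \<rightarrow>\<^sub>E {0, 1}"

definition ones :: "nat \<Rightarrow> (nat \<Rightarrow> nat) \<Rightarrow> nat set" where
  "ones n \<epsilon> = {j \<in> {1..n}. \<epsilon> j = 1}"

text \<open>The edges of \<open>G\<^sub>\<epsilon>\<close>.\<close>
definition edges_of :: "('v, 'e) multigraph \<Rightarrow> ('e \<Rightarrow> nat) \<Rightarrow> (nat \<Rightarrow> nat) \<Rightarrow> 'e set" where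
  "edges_of G s \<epsilon> = {e \<in> edges G. \<epsilon> (s e) = 1}"

definition cochain :: "nat \<Rightarrow> (nat set \<Rightarrow> real) \<Rightarrow> ('v, 'e) multigraph \<Rightarrow> ('e \<Rightarrow> nat) \<Rightarrow> nat
    \<Rightarrow> (nat \<Rightarrow> nat, gen list) fgraded" where
  "cochain d f G s i = (let n = card (edges G) in
     \<lparr>index = {\<epsilon> \<in> edge_vectors n. card (ones n \<epsilon>) = i},
      summand = (\<lambda>\<epsilon>. tensor_power M (ncomp G (edges_of G s \<epsilon>))),
      fvalue = (\<lambda>\<epsilon>. tilde n d f (ones n \<epsilon>))\<rparr>)"

end

(* For a harmonic f of degree d, inclusion-exclusion over the subsets of X turns the sum of f over the
   d-sets avoiding X into (-1)^d times its sum over the d-sets inside X, because the sum of f over all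
   d-sets containing a given set of fewer than d elements is 0. This replaces the complement E - A in
   the weighted chromatic polynomial by A itself, at the cost of the sign (-1)^d. The summand of an
   edge vector has Poincare polynomial (1 + q)^k, as M^(tensor k) has the words of length k as basis.
   Summed over all labels, everything vanishes for d > 0, so there the sign does not matter. *)
theory Submission
  imports Defs "HOL-Combinatorics.Transposition"
begin

section \<open>Harmonic functions\<close>

lemma finite_Omega [simp]: "finite (Omega n d)"
  by (rule finite_subset[of _ "Pow {1..n}"]) (auto simp: Omega_def)

text \<open>Downward induction on the size of \<open>S\<close>. For \<open>card S = d - 1\<close>
  the sum is the coefficient of \<open>S\<close> in \<open>gamma n d f\<close>. For smaller
  \<open>S\<close>, adding up the vanishing sums for all one-point extensions of \<open>S\<close>
  counts every \<open>Z\<close> the same positive number of times.\<close>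

lemma Harm_sum_superset:
  assumes f: "f \<in> Harm d n" and S: "S \<subseteq> {1..n}" "card S < d"
  shows "(\<Sum>Z | Z \<in> Omega n d \<and> S \<subseteq> Z. f Z) = 0"
  using S
proof (induction "d - card S" arbitrary: S rule: less_induct)
  case less
  have finS: "finite S" using less.prems(1) finite_subset by blast
  show ?case
  proof (cases "card S = d - 1")
    case True
    have "0 = gamma n d f S" using f by (simp add: Harm_def)
    also have "\<dots> = (\<Sum>Z\<in>Omega n d. if S \<subseteq> Z then f Z else 0)"
      unfolding gamma_def
    proof (intro sum.cong refl)
      fix Z assume "Z \<in> Omega n d"
      \<comment> \<open>\<open>gamma_coeff\<close> asks for a proper subset, which here is the same
        as a subset because the sizes differ.\<close>
      then have "S \<noteq> Z" using less.prems(2) by (auto simp: Omega_def)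
      then show "f Z * gamma_coeff n d Z S = (if S \<subseteq> Z then f Z else 0)"
        using True less.prems(1) by (auto simp: gamma_coeff_def Omega_def)
    qed
    finally show ?thesis by (simp add: sum.inter_filter)
  next
    case False
    \<comment> \<open>Double counting of pairs \<open>(x, Z)\<close>: a \<open>d\<close>-set
      \<open>Z\<close> containing \<open>S\<close> is reached from each of the
      \<open>d - card S\<close> points of \<open>Z - S\<close>.\<close>
    have "0 = (\<Sum>x\<in>{1..n} - S. \<Sum>Z | Z \<in> Omega n d \<and> insert x S \<subseteq> Z. f Z)"
    proof (rule sym, rule sum.neutral, rule ballI)
      fix x assume x: "x \<in> {1..n} - S"
      then have "card (insert x S) = Suc (card S)" using finS by simp
      with x False less.prems show "(\<Sum>Z | Z \<in> Omega n d \<and> insert x S \<subseteq> Z. f Z) = 0"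
        by (intro less.hyps) auto
    qed
    also have "\<dots> = (\<Sum>Z\<in>Omega n d. \<Sum>x | x \<in> {1..n} - S \<and> insert x S \<subseteq> Z. f Z)"
      by (rule sum.swap_restrict) auto
    also have "\<dots> = (\<Sum>Z\<in>Omega n d. if S \<subseteq> Z then real (d - card S) * f Z else 0)"
    proof (intro sum.cong refl)
      fix Z assume Z: "Z \<in> Omega n d"
      show "(\<Sum>x | x \<in> {1..n} - S \<and> insert x S \<subseteq> Z. f Z) =
              (if S \<subseteq> Z then real (d - card S) * f Z else 0)"
      proof (cases "S \<subseteq> Z")
        case True
        then have "{x. x \<in> {1..n} - S \<and> insert x S \<subseteq> Z} = Z - S"
          using Z by (auto simp: Omega_def)
        moreover have "card (Z - S) = d - card S"
          using True Z finS by (simp add: card_Diff_subset Omega_def)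
        ultimately show ?thesis using True by simp
      qed auto
    qed
    also have "\<dots> = real (d - card S) * (\<Sum>Z | Z \<in> Omega n d \<and> S \<subseteq> Z. f Z)"
      by (simp add: sum_distrib_left flip: sum.inter_filter)
    finally show ?thesis using less.prems(2) by simp
  qed
qed

lemma sum_Pow_alternating:
  assumes "finite T"
  shows "(\<Sum>S\<in>Pow T. (-1) ^ card S) = (if T = {} then 1 else 0 :: real)"
  \<comment> \<open>The expansion of the product of \<open>1 - 1\<close> over \<open>T\<close>,
    which is 0 to the power \<open>card T\<close>.\<close>
  using prod_diff_conv_sum[of T "\<lambda>_. 1 :: real" "\<lambda>_. 1"] assms
  by (auto simp: card_gt_0_iff power_0_left)

lemma tilde_Compl:
  assumes f: "f \<in> Harm d n" and X: "X \<subseteq> {1..n}"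
  shows "tilde n d f ({1..n} - X) = (-1) ^ d * tilde n d f X"
proof -
  have finX: "finite X" using X finite_subset by blast
  have "tilde n d f ({1..n} - X) = (\<Sum>Z\<in>Omega n d. if X \<inter> Z = {} then f Z else 0)"
    unfolding tilde_def sum.inter_filter[OF finite_Omega, symmetric]
    by (intro sum.cong) (auto simp: Omega_def)
  \<comment> \<open>The indicator of \<open>X\<close> and \<open>Z\<close> being disjoint becomes an
    alternating sum over the subsets of their intersection.\<close>
  also have "\<dots> = (\<Sum>Z\<in>Omega n d. \<Sum>S | S \<in> Pow X \<and> S \<subseteq> Z. (-1) ^ card S * f Z)"
  proof (intro sum.cong refl)
    fix Z
    have "{S. S \<in> Pow X \<and> S \<subseteq> Z} = Pow (X \<inter> Z)" by auto
    then show "(if X \<inter> Z = {} then f Z else 0) =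
        (\<Sum>S | S \<in> Pow X \<and> S \<subseteq> Z. (-1) ^ card S * f Z)"
      using sum_Pow_alternating[of "X \<inter> Z"] finX by (simp add: sum_distrib_right[symmetric])
  qed
  also have "\<dots> = (\<Sum>S\<in>Pow X. \<Sum>Z | Z \<in> Omega n d \<and> S \<subseteq> Z. (-1) ^ card S * f Z)"
    by (rule sum.swap_restrict[symmetric]) (auto simp: finX)
  also have "\<dots> = (\<Sum>S\<in>Pow X. if card S = d then (-1) ^ d * f S else 0)"
  proof (intro sum.cong refl)
    fix S assume "S \<in> Pow X"
    then have S: "S \<subseteq> {1..n}" using X by auto
    \<comment> \<open>Small \<open>S\<close> contribute nothing by harmonicity, large ones lie in no
      \<open>d\<close>-set, and for \<open>card S = d\<close> only \<open>Z = S\<close>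
      remains.\<close>
    consider "card S < d" | "card S = d" | "card S > d" by linarith
    then show "(\<Sum>Z | Z \<in> Omega n d \<and> S \<subseteq> Z. (-1) ^ card S * f Z) =
        (if card S = d then (-1) ^ d * f S else 0)"
    proof cases
      case 1
      then show ?thesis using Harm_sum_superset[OF f S] by (simp add: sum_distrib_left[symmetric])
    next
      case 2
      have "{Z. Z \<in> Omega n d \<and> S \<subseteq> Z} = {S}"
        using 2 S by (auto simp: Omega_def dest: card_subset_eq[OF finite_subset[OF _ finite_atLeastAtMost]])
      then show ?thesis using 2 by simp
    next
      case 3
      have "{Z. Z \<in> Omega n d \<and> S \<subseteq> Z} = {}"
        using 3 by (auto simp: Omega_def dest: card_mono[OF finite_subset[OF _ finite_atLeastAtMost]])
      then show ?thesis using 3 by (simp only:) simp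
    qed
  qed
  also have "\<dots> = (\<Sum>S | S \<in> Pow X \<and> card S = d. (-1) ^ d * f S)"
    using finX by (simp add: sum.inter_filter[symmetric])
  also have "{S. S \<in> Pow X \<and> card S = d} = {Z. Z \<in> Omega n d \<and> Z \<subseteq> X}"
    using X by (auto simp: Omega_def)
  finally show ?thesis by (simp add: tilde_def sum_distrib_left)
qed

section \<open>Sums over all labels\<close>

lemma labels_inj_on: "s \<in> labels G \<Longrightarrow> inj_on s (edges G)"
  and labels_image: "s \<in> labels G \<Longrightarrow> s ` edges G = {1..card (edges G)}"
  by (simp_all add: labels_def bij_betw_def)

text \<open>Composing with a transposition of two edges is an involution on labels, so sums over
  labels can be reindexed along it.\<close>

lemma bij_betw_comp_transpose_labels:
  assumes "a \<in> edges G" "b \<in> edges G"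
  shows "bij_betw (\<lambda>s. s \<circ> transpose a b) (labels G) (labels G)"
proof -
  have "s \<circ> transpose a b \<in> labels G" if s: "s \<in> labels G" for s
  proof -
    have bij: "bij_betw (transpose a b) (edges G) (edges G)"
      using assms by (simp add: bij_betw_transpose_iff)
    with s have "bij_betw (s \<circ> transpose a b) (edges G) {1..card (edges G)}"
      by (auto simp: labels_def intro: bij_betw_trans)
    \<comment> \<open>Labels are extensional; the transposition fixes everything outside the edges,
      so the default value survives.\<close>
    moreover have "(s \<circ> transpose a b) x = undefined" if "x \<notin> edges G" for x
      using s that assms by (auto simp: labels_def transpose_def PiE_def extensional_def)
    ultimately show ?thesis
      by (auto simp: labels_def PiE_def extensional_def bij_betw_def)
  qed
  then show ?thesis
    by (intro bij_betw_byWitness[where f' = "\<lambda>s. s \<circ> transpose a b"])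
       (auto simp: comp_assoc transpose_comp_involutory)
qed

text \<open>The sum \<open>h Z\<close> of \<open>f (s ` Z)\<close> over all labels does not change when one element of \<open>Z\<close> is
  replaced by another, whereas harmonicity makes the sum of \<open>h\<close> over all such replacements vanish.\<close>
lemma sum_labels_Harm:
  assumes fin: "finite (edges G)" and n: "card (edges G) = n" and f: "f \<in> Harm d n"
    and Z: "Z \<subseteq> edges G" "card Z = d" and d: "d > 0"
  shows "(\<Sum>s\<in>labels G. f (s ` Z)) = 0"
proof -
  from d Z obtain e where e: "e \<in> Z" by fastforce
  define Y where "Y = Z - {e}"
  have finY: "finite Y" and eY: "e \<notin> Y" and Ze: "Z = insert e Y" and YE: "Y \<subseteq> edges G"
    using Z fin e by (auto simp: Y_def finite_subset)
  have cY: "Suc (card Y) = d" using Z(2) eY finY by (simp add: Ze)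
  \<comment> \<open>Swapping \<open>e\<close> and \<open>x\<close> carries \<open>insert x Y\<close>
    to \<open>Z\<close>, so the two sums differ only by a reindexing of the labels.\<close>
  have const: "(\<Sum>s\<in>labels G. f (s ` insert x Y)) = (\<Sum>s\<in>labels G. f (s ` Z))"
    if x: "x \<in> edges G - Y" for x
  proof -
    have "(\<Sum>s\<in>labels G. f (s ` insert x Y)) =
        (\<Sum>s\<in>labels G. f ((s \<circ> transpose e x) ` insert x Y))"
      using bij_betw_comp_transpose_labels[of e G x] e Z(1) x
      by (intro sum.reindex_bij_betw[symmetric]) auto
    moreover have "transpose e x ` insert x Y = Z"
      using x eY by (force simp: Ze transpose_def)
    then have "(s \<circ> transpose e x) ` insert x Y = s ` Z" for s :: "_ \<Rightarrow> nat"
      by (simp only: image_comp[symmetric])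
    ultimately show ?thesis by (simp only:)
  qed
  \<comment> \<open>For a fixed label, the images of the sets \<open>insert x Y\<close> are exactly
    the \<open>d\<close>-sets containing the image of \<open>Y\<close>, each hit once; that image
    has only \<open>d - 1\<close> elements.\<close>
  have "(\<Sum>x\<in>edges G - Y. f (s ` insert x Y)) = 0" if s: "s \<in> labels G" for s
  proof -
    have bij: "bij_betw s (edges G) {1..n}" using s n by (simp add: labels_def)
    have inj: "inj_on s (edges G)" and im: "s ` edges G = {1..n}"
      using bij by (auto simp: bij_betw_def)
    have sY: "s ` Y \<subseteq> {1..n}" "card (s ` Y) = d - 1"
      using im YE inj cY by (auto simp: card_image inj_on_subset)
    have "(\<Sum>x\<in>edges G - Y. f (s ` insert x Y)) = (\<Sum>y\<in>{1..n} - s ` Y. f (insert y (s ` Y)))"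
      using bij_betw_DiffI[OF bij bij_betw_subset[OF bij YE refl]] YE sY
      by (subst sum.reindex_bij_betw[symmetric, of s "edges G - Y"]) auto
    also have "\<dots> = (\<Sum>W\<in>(\<lambda>y. insert y (s ` Y)) ` ({1..n} - s ` Y). f W)"
      by (subst sum.reindex) (auto simp: inj_on_def)
    also have "(\<lambda>y. insert y (s ` Y)) ` ({1..n} - s ` Y) = {W. W \<in> Omega n d \<and> s ` Y \<subseteq> W}"
    proof (intro equalityI subsetI)
      fix W assume "W \<in> {W. W \<in> Omega n d \<and> s ` Y \<subseteq> W}"
      then have W: "W \<subseteq> {1..n}" "card W = d" "s ` Y \<subseteq> W" by (auto simp: Omega_def)
      then have "card (W - s ` Y) = 1"
        using finY sY cY by (simp add: card_Diff_subset)
      then obtain y where "W - s ` Y = {y}" by (auto simp: card_1_singleton_iff)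
      with W have "W = insert y (s ` Y)" "y \<in> {1..n} - s ` Y" by auto
      then show "W \<in> (\<lambda>y. insert y (s ` Y)) ` ({1..n} - s ` Y)" by blast
    next
      fix W assume "W \<in> (\<lambda>y. insert y (s ` Y)) ` ({1..n} - s ` Y)"
      then show "W \<in> {W. W \<in> Omega n d \<and> s ` Y \<subseteq> W}"
        using sY finY d by (auto simp: Omega_def)
    qed
    also have "(\<Sum>W | W \<in> Omega n d \<and> s ` Y \<subseteq> W. f W) = 0"
      using sY d by (intro Harm_sum_superset[OF f]) auto
    finally show ?thesis .
  qed
  then have "0 = (\<Sum>s\<in>labels G. \<Sum>x\<in>edges G - Y. f (s ` insert x Y))" by simp
  also have "\<dots> = (\<Sum>x\<in>edges G - Y. \<Sum>s\<in>labels G. f (s ` insert x Y))" by (rule sum.swap)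
  also have "\<dots> = real (card (edges G - Y)) * (\<Sum>s\<in>labels G. f (s ` Z))"
    by (simp only: const sum_constant cong: sum.cong)
  finally have "real (card (edges G - Y)) * (\<Sum>s\<in>labels G. f (s ` Z)) = 0" by simp
  \<comment> \<open>The removed edge \<open>e\<close> itself lies in
    \<open>edges G - Y\<close>.\<close>
  moreover have "card (edges G - Y) \<noteq> 0" using fin e Z(1) eY by auto
  ultimately show ?thesis by simp
qed

text \<open>A label matches the \<open>d\<close>-subsets of \<open>B\<close> with those of its
  image. The index set of the inner sum thus no longer depends on the label, and exchanging the sums
  reduces the claim to single \<open>d\<close>-sets.\<close>

lemma sum_labels_tilde:
  assumes fin: "finite (edges G)" and n: "card (edges G) = n" and f: "f \<in> Harm d n"
    and B: "B \<subseteq> edges G" and d: "d > 0"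
  shows "(\<Sum>s\<in>labels G. tilde n d f (s ` B)) = 0"
proof -
  have "tilde n d f (s ` B) = (\<Sum>Z | Z \<subseteq> B \<and> card Z = d. f (s ` Z))" if s: "s \<in> labels G" for s
  proof -
    have inj: "inj_on s B" and im: "s ` B \<subseteq> {1..n}"
      using inj_on_subset[OF labels_inj_on[OF s] B] image_mono[OF B, of s] labels_image[OF s] n
      by simp_all
    have *: "{Z. Z \<in> Omega n d \<and> Z \<subseteq> s ` B} = (`) s ` {Z. Z \<subseteq> B \<and> card Z = d}"
    proof (intro equalityI subsetI)
      fix W assume "W \<in> {Z. Z \<in> Omega n d \<and> Z \<subseteq> s ` B}"
      then obtain Z where "Z \<subseteq> B" "W = s ` Z" "card W = d"
        by (auto simp: Omega_def subset_image_iff)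
      moreover from this have "card Z = d"
        using card_image[OF inj_on_subset[OF inj], of Z] by simp
      ultimately show "W \<in> (`) s ` {Z. Z \<subseteq> B \<and> card Z = d}" by blast
    next
      fix W assume "W \<in> (`) s ` {Z. Z \<subseteq> B \<and> card Z = d}"
      then show "W \<in> {Z. Z \<in> Omega n d \<and> Z \<subseteq> s ` B}"
        using inj im by (auto simp: Omega_def card_image inj_on_subset)
    qed
    have "inj_on ((`) s) {Z. Z \<subseteq> B \<and> card Z = d}"
      by (rule inj_on_subset[OF inj_on_image_Pow[OF inj]]) auto
    then show ?thesis unfolding tilde_def * by (simp add: sum.reindex)
  qed
  then have "(\<Sum>s\<in>labels G. tilde n d f (s ` B)) =
      (\<Sum>s\<in>labels G. \<Sum>Z | Z \<subseteq> B \<and> card Z = d. f (s ` Z))" by simp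
  also have "\<dots> = (\<Sum>Z | Z \<subseteq> B \<and> card Z = d. \<Sum>s\<in>labels G. f (s ` Z))" by (rule sum.swap)
  also have "\<dots> = 0"
    using B by (intro sum.neutral ballI sum_labels_Harm[OF fin n f _ _ d]) auto
  finally show ?thesis .
qed

section \<open>Graded dimensions of cochain groups\<close>

interpretation frag: module frag_cmul
  by unfold_locales (simp_all add: frag_cmul_distrib frag_cmul_distrib2)

lemma lookup_qscale [simp]: "Poly_Mapping.lookup (qscale r p) w = r * Poly_Mapping.lookup p w"
  by (simp add: qscale_def Poly_Mapping.map.rep_eq when_def)

interpretation qscale: vector_space qscale
  by unfold_locales (auto intro!: poly_mapping_eqI simp: lookup_add algebra_simps)

lemma lookup_map_of_int [simp]:
  "Poly_Mapping.lookup (Poly_Mapping.map rat_of_int p) w = rat_of_int (Poly_Mapping.lookup p w)"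
  by (simp add: Poly_Mapping.map.rep_eq when_def)

lemma single_eq_1_iff:
  "Poly_Mapping.single v (1 :: 'b :: zero_neq_one) = Poly_Mapping.single w 1 \<longleftrightarrow> v = w"
  by (metis lookup_single_eq lookup_single_not_eq one_neq_zero)

text \<open>Read as tensors of generators, these words will be the basis of the degree
  \<open>j\<close> part of the \<open>k\<close>-th tensor power of \<open>M\<close>.\<close>

definition words :: "nat \<Rightarrow> nat \<Rightarrow> gen list set" where
  "words k j = {w. length w = k \<and> sum_list (map gen_deg w) = j}"

text \<open>Splitting by the first letter gives Pascal's rule. The case \<open>j = 0\<close> is set
  apart because truncated subtraction would make \<open>j - 1\<close> equal to 0 and admit words of
  degree 1.\<close>

lemma words_Suc:
  "words (Suc k) j = (#) Gen_1 ` words k j \<union> (if j = 0 then {} else (#) Gen_x ` words k (j - 1))"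
proof -
  have "w \<in> words (Suc k) j \<longleftrightarrow>
      w \<in> (#) Gen_1 ` words k j \<union> (if j = 0 then {} else (#) Gen_x ` words k (j - 1))" for w
  proof (cases w)
    case (Cons g u)
    then show ?thesis by (cases g) (auto simp: words_def)
  qed (auto simp: words_def)
  then show ?thesis by blast
qed

lemma finite_words_card_words: "finite (words k j) \<and> card (words k j) = k choose j"
proof (induction k arbitrary: j)
  case 0
  have "words 0 j = (if j = 0 then {[]} else {})" by (auto simp: words_def)
  then show ?case by (simp add: binomial_eq_0)
next
  case (Suc k)
  note IH = Suc.IH
  show ?case
  proof (cases j)
    case 0
    then show ?thesis using IH by (simp add: words_Suc card_image)
  next
    case (Suc i)
    have "card ((#) Gen_1 ` words k j \<union> (#) Gen_x ` words k i) =
        card (words k j) + card (words k i)"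
      by (subst card_Un_disjoint) (auto simp: IH card_image)
    then show ?thesis using Suc by (simp add: words_Suc IH)
  qed
qed

lemma keys_M: "m \<in> M j \<Longrightarrow> w \<in> Poly_Mapping.keys m \<Longrightarrow> gen_deg w = j"
  unfolding M_def
proof (induction arbitrary: w rule: frag.span_induct_alt)
  case (step c x y)
  then show ?case using keys_add[of "frag_cmul c x" y] by (auto simp: keys_frag_of)
qed simp

lemma in_listset_iff:
  "w \<in> listset As \<longleftrightarrow> length w = length As \<and> (\<forall>i<length As. w ! i \<in> As ! i)"
proof (induction As arbitrary: w)
  case (Cons A As)
  show ?case
    by (cases w) (auto simp: set_Cons_def Cons.IH nth_Cons All_less_Suc2 split: nat.split)
qed simp

text \<open>A pure tensor of homogeneous elements expands into words whose letters have exactly the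
  degrees \<open>ds\<close>. Conversely, a word is the pure tensor of its own letters.\<close>

lemma tensor_power_M: "tensor_power M k j = zspan (frag_of ` words k j)"
proof (rule antisym)
  show "tensor_power M k j \<subseteq> zspan (frag_of ` words k j)"
    unfolding tensor_power_def
  proof (intro frag.span_minimal subsetI frag.subspace_span)
    fix p assume "p \<in> {pure_tensor ms | ms ds. length ms = k \<and> length ds = k \<and>
        (\<forall>i<k. ms ! i \<in> M (ds ! i)) \<and> sum_list ds = j}"
    then obtain ms ds where p: "p = pure_tensor ms" and l: "length ms = k" "length ds = k"
      and ms: "\<forall>i<k. ms ! i \<in> M (ds ! i)" and ds: "sum_list ds = j" by auto
    have "w \<in> words k j" if w: "w \<in> listset (map Poly_Mapping.keys ms)" for w
    proof -
      have "length w = k" using w l by (simp add: in_listset_iff)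
      moreover from this have "map gen_deg w = ds"
        using w l ms by (intro nth_equalityI) (auto simp: in_listset_iff intro: keys_M)
      ultimately show ?thesis using ds by (simp add: words_def)
    qed
    then show "p \<in> zspan (frag_of ` words k j)"
      unfolding p pure_tensor_def
      by (intro frag.span_sum frag.span_scale frag.span_base) auto
  qed
  show "zspan (frag_of ` words k j) \<subseteq> tensor_power M k j"
    unfolding tensor_power_def
  proof (intro frag.span_mono image_subsetI)
    fix w assume w: "w \<in> words k j"
    have "listset (map Poly_Mapping.keys (map frag_of w)) = {w}"
      by (auto simp: in_listset_iff keys_frag_of intro: nth_equalityI)
    then have "frag_of w = pure_tensor (map frag_of w)" by (simp add: pure_tensor_def)
    moreover have "\<forall>i<k. map frag_of w ! i \<in> M (map gen_deg w ! i)"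
      using w by (auto simp: words_def M_def intro!: frag.span_base)
    ultimately show "frag_of w \<in> {pure_tensor ms | ms ds. length ms = k \<and> length ds = k \<and>
        (\<forall>i<k. ms ! i \<in> M (ds ! i)) \<and> sum_list ds = j}"
      using w by (auto simp: words_def intro!: exI[of _ "map frag_of w"] exI[of _ "map gen_deg w"])
  qed
qed

text \<open>Passing to rational coefficients sends the integral basis vector of \<open>w\<close> to
  the rational one and integral combinations to rational ones.\<close>

lemma rationalization_zspan_frag_of:
  fixes W :: "'a set"
  shows "rationalization (zspan (frag_of ` W)) = qscale.span ((\<lambda>w. Poly_Mapping.single w 1) ` W)"
proof (rule antisym)
  have "Poly_Mapping.map rat_of_int p \<in> qscale.span ((\<lambda>w. Poly_Mapping.single w 1) ` W)"
    if "p \<in> zspan (frag_of ` W)" for p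
    using that
  proof (induction rule: frag.span_induct_alt)
    case base
    have "Poly_Mapping.map rat_of_int (0 :: 'a \<Rightarrow>\<^sub>0 int) = 0" by (auto intro: poly_mapping_eqI)
    then show ?case by (simp add: qscale.span_zero)
  next
    case (step c x y)
    then obtain w where w: "w \<in> W" "x = frag_of w" by auto
    have "Poly_Mapping.map rat_of_int (frag_cmul c x + y) =
        qscale (rat_of_int c) (Poly_Mapping.single w 1) + Poly_Mapping.map rat_of_int y"
      by (auto intro!: poly_mapping_eqI simp: lookup_add w lookup_single when_def)
    moreover have "Poly_Mapping.single w 1 \<in> qscale.span ((\<lambda>w. Poly_Mapping.single w 1) ` W)"
      using w by (intro qscale.span_base) simp
    ultimately show ?case
      using step by (simp add: qscale.span_add qscale.span_scale)
  qed
  then show "rationalization (zspan (frag_of ` W)) \<subseteq>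
      qscale.span ((\<lambda>w. Poly_Mapping.single w 1) ` W)"
    unfolding rationalization_def
    by (intro qscale.span_minimal qscale.subspace_span) auto
  have "Poly_Mapping.single w 1 \<in> Poly_Mapping.map rat_of_int ` zspan (frag_of ` W)" if "w \<in> W" for w
  proof (rule image_eqI)
    show "Poly_Mapping.single w 1 = Poly_Mapping.map rat_of_int (frag_of w)"
      by (auto intro!: poly_mapping_eqI simp: lookup_single when_def)
    show "frag_of w \<in> zspan (frag_of ` W)" using that by (intro frag.span_base) simp
  qed
  then show "qscale.span ((\<lambda>w. Poly_Mapping.single w 1) ` W) \<subseteq>
      rationalization (zspan (frag_of ` W))"
    unfolding rationalization_def
    by (intro qscale.span_mono) blast
qed

lemma independent_single: "qscale.independent ((\<lambda>w. Poly_Mapping.single w 1) ` W)"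
  unfolding qscale.independent_explicit_module
proof (intro allI impI)
  fix t u v assume t: "finite t" "t \<subseteq> (\<lambda>w. Poly_Mapping.single w 1) ` W"
    and sum: "(\<Sum>v\<in>t. qscale (u v) v) = 0" and v: "v \<in> t"
  then obtain w where w: "v = Poly_Mapping.single w 1" by auto
  \<comment> \<open>Reading off the coefficient at \<open>w\<close> isolates the scalar
    \<open>u v\<close>.\<close>
  have "0 = Poly_Mapping.lookup (\<Sum>v\<in>t. qscale (u v) v) w" by (simp add: sum)
  also have "\<dots> = (\<Sum>x\<in>t. if x = v then u v else 0)"
    unfolding lookup_sum
  proof (intro sum.cong refl)
    fix x assume "x \<in> t"
    then obtain y where "x = Poly_Mapping.single y 1" using t by auto
    then show "Poly_Mapping.lookup (qscale (u x) x) w = (if x = v then u v else 0)"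
      by (auto simp: w lookup_single when_def single_eq_1_iff)
  qed
  finally show "u v = 0" using t v by simp
qed

lemma qdim_tensor_power_M: "qdim (tensor_power M k j) = k choose j"
proof -
  have "inj_on (\<lambda>w :: gen list. Poly_Mapping.single w (1 :: rat)) (words k j)"
    by (auto simp: inj_on_def single_eq_1_iff)
  then show ?thesis
    unfolding qdim_def tensor_power_M rationalization_zspan_frag_of
      qscale.dim_span_eq_card_independent[OF independent_single]
    by (simp add: card_image finite_words_card_words)
qed

text \<open>Coefficients are compared: degree \<open>i\<close> of the \<open>k\<close>-th tensor
  power has rank \<open>k choose i\<close>, which is the coefficient of \<open>q^i\<close> in
  \<open>(1 + q)^k\<close>.\<close>

lemma fqdim_tensor_powers:
  assumes "finite I"
  shows "fqdim \<lparr>index = I, summand = \<lambda>a. tensor_power M (k a), fvalue = v\<rparr> =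
    (\<Sum>a\<in>I. smult (v a) ([:1, 1:] ^ k a))"
proof -
  \<comment> \<open>The degrees that \<open>fqdim\<close> sums over. \<open>J\<close> must be shown
    finite, since a sum over an infinite set would default to 0; degrees outside \<open>J\<close>
    have rank 0.\<close>
  define J where "J = {j. \<exists>a\<in>I. tensor_power M (k a) j \<noteq> {0}}"
  have qdim_0: "qdim {0 :: gen list \<Rightarrow>\<^sub>0 int} = 0"
  proof -
    \<comment> \<open>The zero module is realised as the degree 1 part of the empty tensor power,
      whose rank \<open>0 choose 1\<close> is already known.\<close>
    have "words 0 1 = {}" by (auto simp: words_def)
    then have "tensor_power M 0 1 = {0}" by (simp add: tensor_power_M)
    then show ?thesis using qdim_tensor_power_M[of 0 1] by simp
  qed
  have nonzero: "j \<le> k a" if "tensor_power M (k a) j \<noteq> {0}" for a j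
  proof (rule ccontr)
    assume "\<not> j \<le> k a"
    then have "words (k a) j = {}"
      using finite_words_card_words[of "k a" j] by (auto simp: binomial_eq_0)
    then show False using that by (simp add: tensor_power_M)
  qed
  have finJ: "finite J"
    by (rule finite_subset[of _ "\<Union>a\<in>I. {..k a}"]) (use nonzero assms in \<open>auto simp: J_def\<close>)
  have "coeff (fqdim \<lparr>index = I, summand = \<lambda>a. tensor_power M (k a), fvalue = v\<rparr>) i =
      (\<Sum>a\<in>I. v a * real (k a choose i))" for i
  proof -
    have "coeff (fqdim \<lparr>index = I, summand = \<lambda>a. tensor_power M (k a), fvalue = v\<rparr>) i =
        (if i \<in> J then \<Sum>a\<in>I. v a * real (k a choose i) else 0)"
      using finJ by (simp add: fqdim_def frank_def J_def[symmetric] coeff_sum qdim_tensor_power_M)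
    moreover have "v a * real (k a choose i) = 0" if "i \<notin> J" "a \<in> I" for a
      using that qdim_0 qdim_tensor_power_M[of "k a" i] by (force simp: J_def)
    ultimately show ?thesis by (simp add: sum.neutral)
  qed
  moreover have "coeff ([:1, 1:] ^ m) i = real (m choose i)" for m i
  proof (cases "i \<le> m")
    case True
    then show ?thesis using coeff_linear_poly_power[of i m 1 "1 :: real"] by simp
  next
    case False
    then have "degree ([:1, 1 :: real:] ^ m) < i" by (simp add: degree_power_eq)
    then show ?thesis using False by (simp add: coeff_eq_0)
  qed
  ultimately show ?thesis by (intro poly_eqI) (simp add: coeff_sum)
qed

section \<open>Cochain groups indexed by edge sets\<close>

lemma bij_betw_edges_of:
  fixes G :: "('v, 'e) multigraph"
  assumes s: "s \<in> labels G" and n: "card (edges G) = n"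
  shows "bij_betw (edges_of G s) (edge_vectors n) (Pow (edges G))"
proof -
  \<comment> \<open>The inverse map: the indicator vector of the labels of \<open>A\<close>,
    restricted to \<open>{1..n}\<close> so that it is extensional like the members of
    \<open>edge_vectors\<close>.\<close>
  define \<delta> :: "'e set \<Rightarrow> nat \<Rightarrow> nat" where "\<delta> A = (\<lambda>j\<in>{1..n}. of_bool (j \<in> s ` A))" for A
  have inj: "inj_on s (edges G)" and im: "s ` edges G = {1..n}"
    using labels_inj_on[OF s] labels_image[OF s] n by simp_all
  have left: "\<forall>\<epsilon>\<in>edge_vectors n. \<delta> (edges_of G s \<epsilon>) = \<epsilon>"
  proof (intro ballI ext)
    fix \<epsilon> j assume \<epsilon>: "\<epsilon> \<in> edge_vectors n"
    show "\<delta> (edges_of G s \<epsilon>) j = \<epsilon> j"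
    proof (cases "j \<in> {1..n}")
      case True
      then obtain e where "e \<in> edges G" "j = s e" using im by blast
      moreover have "\<epsilon> j \<in> {0, 1}"
        using \<epsilon> True unfolding edge_vectors_def by (rule PiE_mem)
      ultimately show ?thesis using True by (auto simp: edges_of_def \<delta>_def)
    next
      case False
      then show ?thesis using \<epsilon> by (auto simp: edge_vectors_def \<delta>_def PiE_def extensional_def)
    qed
  qed
  have right: "\<forall>A\<in>Pow (edges G). edges_of G s (\<delta> A) = A"
  proof
    fix A assume A: "A \<in> Pow (edges G)"
    have "\<delta> A (s e) = of_bool (e \<in> A)" if "e \<in> edges G" for e
    proof -
      have "s e \<in> {1..n}" using im that by blast
      then show ?thesis
        using that A inj_on_image_mem_iff[OF inj, of e A] by (simp add: \<delta>_def)
    qed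
    then have "e \<in> edges_of G s (\<delta> A) \<longleftrightarrow> e \<in> A" for e
      using A by (auto simp: edges_of_def of_bool_def split: if_splits)
    then show "edges_of G s (\<delta> A) = A" by blast
  qed
  have into: "edges_of G s ` edge_vectors n \<subseteq> Pow (edges G)" by (auto simp: edges_of_def)
  have onto: "\<delta> ` Pow (edges G) \<subseteq> edge_vectors n"
    by (auto simp: edge_vectors_def \<delta>_def)
  from left right into onto show ?thesis by (rule bij_betw_byWitness)
qed

lemma ones_eq_image_edges_of:
  assumes "s \<in> labels G" and "card (edges G) = n"
  shows "ones n \<epsilon> = s ` edges_of G s \<epsilon>"
proof -
  have "s ` edges G = {1..n}" using assms by (simp add: labels_image)
  then show ?thesis by (auto simp: ones_def edges_of_def)
qed

text \<open>Grouping edge vectors by their number of ones, at most \<open>n\<close>, makes the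
  double sum one over edge sets. The coefficients \<open>c\<close> stay arbitrary so that both sign
  conventions are covered.\<close>

lemma sum_fqdim_cochain:
  fixes c :: "nat \<Rightarrow> real poly"
  assumes s: "s \<in> labels G" and n: "card (edges G) = n"
  shows "(\<Sum>i\<le>n. c i * fqdim (cochain d f G s i)) =
    (\<Sum>A\<in>Pow (edges G). c (card A) * smult (tilde n d f (s ` A)) ([:1, 1:] ^ ncomp G A))"
proof -
  let ?I = "\<lambda>i. {\<epsilon> \<in> edge_vectors n. card (ones n \<epsilon>) = i}"
  let ?t = "\<lambda>\<epsilon>. smult (tilde n d f (ones n \<epsilon>)) ([:1, 1:] ^ ncomp G (edges_of G s \<epsilon>)) :: real poly"
  have fin: "finite (edge_vectors n)" by (simp add: edge_vectors_def finite_PiE)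
  have le: "card (ones n \<epsilon>) \<le> n" for \<epsilon>
  proof -
    have "card (ones n \<epsilon>) \<le> card {1..n}" by (rule card_mono) (auto simp: ones_def)
    then show ?thesis by simp
  qed
  have "fqdim (cochain d f G s i) = (\<Sum>\<epsilon>\<in>?I i. ?t \<epsilon>)" for i
    using fin by (simp add: cochain_def n fqdim_tensor_powers)
  then have "(\<Sum>i\<le>n. c i * fqdim (cochain d f G s i)) =
      (\<Sum>i\<le>n. \<Sum>\<epsilon>\<in>?I i. c (card (ones n \<epsilon>)) * ?t \<epsilon>)"
    by (simp add: sum_distrib_left)
  also have "\<dots> = (\<Sum>\<epsilon>\<in>edge_vectors n. c (card (ones n \<epsilon>)) * ?t \<epsilon>)"
    using fin le by (intro sum.group) auto
  also have "\<dots> = (\<Sum>\<epsilon>\<in>edge_vectors n. c (card (edges_of G s \<epsilon>)) *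
      smult (tilde n d f (s ` edges_of G s \<epsilon>)) ([:1, 1:] ^ ncomp G (edges_of G s \<epsilon>)))"
  proof (intro sum.cong refl)
    fix \<epsilon>
    have "inj_on s (edges_of G s \<epsilon>)"
      by (rule inj_on_subset[OF labels_inj_on[OF s]]) (auto simp: edges_of_def)
    then show "c (card (ones n \<epsilon>)) * ?t \<epsilon> = c (card (edges_of G s \<epsilon>)) *
      smult (tilde n d f (s ` edges_of G s \<epsilon>)) ([:1, 1:] ^ ncomp G (edges_of G s \<epsilon>))"
      by (simp add: ones_eq_image_edges_of[OF s n] card_image)
  qed
  also have "\<dots> = (\<Sum>A\<in>Pow (edges G). c (card A) * smult (tilde n d f (s ` A)) ([:1, 1:] ^ ncomp G A))"
    by (rule sum.reindex_bij_betw[OF bij_betw_edges_of[OF s n]])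
  finally show ?thesis .
qed

section \<open>The chromatic polynomial at \<open>1 + q\<close>\<close>

lemma pcompose_monom: "pcompose (monom a k) p = smult a (p ^ k)" for p :: "'a :: comm_ring_1 poly"
  by (induction k) (simp_all add: monom_0 monom_Suc pcompose_pCons)

text \<open>The two sides agree term by term in \<open>A\<close>: substitution yields
  \<open>(1 + q)\<close> to the number of components, and complementation supplies the sign
  \<open>(-1) ^ d\<close>.\<close>

lemma pcompose_wchrom:
  assumes s: "s \<in> labels G" and n: "card (edges G) = n" and f: "f \<in> Harm d n"
  shows "pcompose (wchrom d f G s) [:1, 1:] =
    (\<Sum>i\<le>n. (-1) ^ (i + d) * fqdim (cochain d f G s i))"
proof -
  have "tilde n d f (s ` (edges G - A)) = (-1) ^ d * tilde n d f (s ` A)" if "A \<subseteq> edges G" for A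
  proof -
    have "inj_on s (edges G)" "s ` edges G = {1..n}"
      using labels_inj_on[OF s] labels_image[OF s] n by simp_all
    with that have "s ` (edges G - A) = {1..n} - s ` A" "s ` A \<subseteq> {1..n}"
      by (auto simp: inj_on_image_set_diff[of s "edges G"])
    with f show ?thesis by (simp only: tilde_Compl)
  qed
  then show ?thesis
    unfolding sum_fqdim_cochain[OF s n] wchrom_def n pcompose_sum pcompose_monom
    by (intro sum.cong refl) (auto simp: minus_one_power_iff)
qed

text \<open>Once the sum is over edge sets \<open>A\<close>, the label enters only through
  \<open>tilde\<close>, because \<open>card A\<close> and \<open>ncomp G A\<close> do not involve
  it. The label sum of \<open>tilde\<close> vanishes, whatever \<open>c\<close> is.\<close>

lemma sum_labels_fqdim_cochain:
  fixes c :: "nat \<Rightarrow> real poly"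
  assumes "finite (edges G)" and n: "card (edges G) = n" and "f \<in> Harm d n" and "d > 0"
  shows "(\<Sum>s\<in>labels G. \<Sum>i\<le>n. c i * fqdim (cochain d f G s i)) = 0"
proof -
  have "(\<Sum>s\<in>labels G. \<Sum>i\<le>n. c i * fqdim (cochain d f G s i)) =
      (\<Sum>s\<in>labels G. \<Sum>A\<in>Pow (edges G).
        c (card A) * smult (tilde n d f (s ` A)) ([:1, 1:] ^ ncomp G A))"
    by (intro sum.cong refl sum_fqdim_cochain n)
  also have "\<dots> = (\<Sum>A\<in>Pow (edges G). \<Sum>s\<in>labels G.
        c (card A) * smult (tilde n d f (s ` A)) ([:1, 1:] ^ ncomp G A))"
    by (rule sum.swap)
  also have "\<dots> = (\<Sum>A\<in>Pow (edges G).
        c (card A) * smult (\<Sum>s\<in>labels G. tilde n d f (s ` A)) ([:1, 1:] ^ ncomp G A))"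
    by (simp add: sum_distrib_left smult_sum)
  also have "\<dots> = 0"
    using sum_labels_tilde[OF assms(1-3) _ assms(4)] by (intro sum.neutral) simp
  finally show ?thesis .
qed

theorem theorem7p1:
  fixes G :: "('v, 'e) multigraph" and f :: "nat set \<Rightarrow> real" and n d :: nat
  assumes "finite_multigraph G"
    and "card (edges G) = n"
    and "f \<in> Harm d n"
  shows "(odd d \<longrightarrow> (\<forall>s\<in>labels G.
            pcompose (wchrom d f G s) [:1, 1:] =
              (\<Sum>i\<le>n. (-1) ^ (i + 1) * fqdim (cochain d f G s i)))) \<and>
         (d > 0 \<longrightarrow>
            pcompose (wchrom_sum d f G) [:1, 1:] =
              (\<Sum>s\<in>labels G. \<Sum>i\<le>n. (-1) ^ (i + 1) * fqdim (cochain d f G s i))) \<and>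
         (\<forall>s\<in>labels G.
            pcompose (wchrom d f G s) [:1, 1:] =
              (\<Sum>i\<le>n. (-1) ^ (i + d) * fqdim (cochain d f G s i))) \<and>
         pcompose (wchrom_sum d f G) [:1, 1:] =
              (\<Sum>s\<in>labels G. \<Sum>i\<le>n. (-1) ^ (i + d) * fqdim (cochain d f G s i))"
proof -
  have fin: "finite (edges G)" using assms(1) by (simp add: finite_multigraph_def)
  have single: "pcompose (wchrom d f G s) [:1, 1:] =
      (\<Sum>i\<le>n. (-1) ^ (i + d) * fqdim (cochain d f G s i))" if "s \<in> labels G" for s
    using that assms(2,3) by (rule pcompose_wchrom)
  then have total: "pcompose (wchrom_sum d f G) [:1, 1:] =
      (\<Sum>s\<in>labels G. \<Sum>i\<le>n. (-1) ^ (i + d) * fqdim (cochain d f G s i))"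
    by (simp add: wchrom_sum_def pcompose_sum)
  show ?thesis
  proof (intro conjI impI ballI)
    fix s assume "odd d" "s \<in> labels G"
    then show "pcompose (wchrom d f G s) [:1, 1:] =
        (\<Sum>i\<le>n. (-1) ^ (i + 1) * fqdim (cochain d f G s i))"
      by (simp add: single power_add)
  next
    assume "d > 0"
    \<comment> \<open>Both sides are 0, so the two signs cannot be told apart.\<close>
    then show "pcompose (wchrom_sum d f G) [:1, 1:] =
        (\<Sum>s\<in>labels G. \<Sum>i\<le>n. (-1) ^ (i + 1) * fqdim (cochain d f G s i))"
      by (simp only: total sum_labels_fqdim_cochain[OF fin assms(2,3)])
  qed (fact single total)+
qed

end
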